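(* Let $\mathcal{X}$ be a nonempty Polish space, $\mathcal{Y}=\mathbb{R}$ (so $d=1$), $p=1$, let $\nu\in\mathcal{P}_1(\mathbb{R})$ be atomless, and let $\phi:\mathcal{X}\to\mathbb{R}$ be measurable and injective. Then minimizers of $\sigma\mapsto W_1(\phi\#\sigma,\nu)$ over $\sigma\in\mathcal{P}(\mathcal{X})$ are unique (i.e. any two minimizers coincide) if and only if the problem is feasible, i.e. $\inf_{\sigma\in\mathcal{P}(\mathcal{X})}W_1(\phi\#\sigma,\nu)<+\infty$.
   Context: $\mathcal{P}(\cdot)$ denotes Borel probability measures, $\mathcal{P}_1(\mathbb{R})$ those with finite first moment. $\phi\#\sigma$ is the pushforward of $\sigma$ by $\phi$. $W_1(\mu_1,\mu_2)=\inf_\Gamma\int|y'-y|\,d\Gamma(y',y)\in[0,\infty]$, the infimum over couplings of $\mu_1,\mu_2$. A minimizer is any $\sigma_*\in\mathcal{P}(\mathcal{X})$ attaining the infimum. *)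

theory Defs
  imports "HOL-Probability.Probability"
begin

abbreviation borel_probs :: "'a::topological_space measure set" where
  "borel_probs \<equiv> space (prob_algebra borel)"

definition borel_probs1 :: "real measure set" where
  "borel_probs1 = {\<mu> \<in> borel_probs. integrable \<mu> (\<lambda>y. \<bar>y\<bar>)}"

text \<open>Usual measure-theoretic definition for finite measures: no atoms, where an atom is a
  measurable set of positive measure that has no measurable subset of strictly
  intermediate measure.\<close>

definition atomless :: "'a measure \<Rightarrow> bool" where
  "atomless M \<longleftrightarrow>
     (\<forall>A\<in>sets M. 0 < emeasure M A \<longrightarrow>
        (\<exists>B\<in>sets M. B \<subseteq> A \<and> 0 < emeasure M B \<and> emeasure M B < emeasure M A))"

definition couplings :: "real measure \<Rightarrow> real measure \<Rightarrow> (real \<times> real) measure set" where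
  "couplings \<mu>1 \<mu>2 =
     {\<Gamma> \<in> borel_probs. distr \<Gamma> borel fst = \<mu>1 \<and> distr \<Gamma> borel snd = \<mu>2}"

definition W1 :: "real measure \<Rightarrow> real measure \<Rightarrow> ennreal" where
  "W1 \<mu>1 \<mu>2 = (INF \<Gamma>\<in>couplings \<mu>1 \<mu>2. \<integral>\<^sup>+(y', y). ennreal \<bar>y' - y\<bar> \<partial>\<Gamma>)"

definition W1_objective :: "('a::topological_space \<Rightarrow> real) \<Rightarrow> real measure \<Rightarrow> 'a measure \<Rightarrow> ennreal" where
  "W1_objective \<phi> \<nu> \<sigma> = W1 (distr \<sigma> borel \<phi>) \<nu>"

text \<open>If the infimum is infinite, every Borel probability measure is a minimizer.\<close>

definition is_W1_minimizer :: "('a::topological_space \<Rightarrow> real) \<Rightarrow> real measure \<Rightarrow> 'a measure \<Rightarrow> bool" where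
  "is_W1_minimizer \<phi> \<nu> \<sigma> \<longleftrightarrow>
     \<sigma> \<in> borel_probs \<and> W1_objective \<phi> \<nu> \<sigma> = (INF \<sigma>'\<in>borel_probs. W1_objective \<phi> \<nu> \<sigma>')"

end

theory Submission
  imports Defs
begin

text \<open>
  Let \<open>S\<close> be the closure of the range of \<open>\<phi>\<close>. Moving each point almost to its nearest point of
  \<open>S\<close> shows that the infimum is at most \<open>\<integral> dist(y, S) d\<nu>(y)\<close>, which is finite. Hence a
  minimizer \<open>\<sigma>\<close> has couplings of \<open>\<phi>#\<sigma>\<close> and \<open>\<nu>\<close> that move almost no mass to
  non-nearest points of \<open>S\<close>, so \<open>(\<phi>#\<sigma>)(C) \<le> \<nu>{y. dist(y, S \<inter> C) = dist(y, S)}\<close> for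
  closed \<open>C\<close>. For the half lines \<open>{..a}\<close> and \<open>{b..}\<close> with \<open>a < b\<close> the two sets
  on the right share at most the midpoint of a gap of \<open>S\<close>, a null set of \<open>\<nu>\<close>; this
  determines the distribution function of \<open>\<phi>#\<sigma>\<close>. Finally, \<open>\<phi>#\<sigma>\<close> determines \<open>\<sigma>\<close> by
  injectivity, through the compact subsets of the graph of \<open>\<phi>\<close>.
\<close>

section \<open>Atoms, and recovering a measure from its injective image\<close>

lemma atomless_emeasure_singleton:
  assumes "atomless M" "{x} \<in> sets M"
  shows "emeasure M {x} = 0"
proof (rule ccontr)
  assume "emeasure M {x} \<noteq> 0"
  then have "0 < emeasure M {x}" by (simp add: zero_less_iff_neq_zero)
  with assms obtain B where "B \<subseteq> {x}" "0 < emeasure M B" "emeasure M B < emeasure M {x}"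
    unfolding atomless_def by metis
  then show False
    by (auto simp: subset_singleton_iff)
qed

text \<open>Mass is tracked on compact subsets \<open>K\<close> of the graph of \<phi> over
  \<open>B\<close>. Both projections of \<open>K\<close> are compact, hence Borel, and by
  injectivity the first is the \<phi>-preimage of the second, so equal pushforwards give it equal
  mass under both measures. Inner regularity of the law on the graph passes from \<open>K\<close> to
  \<open>B\<close>.\<close>

lemma emeasure_le_of_distr_inj_eq:
  fixes \<phi> :: "'a::polish_space \<Rightarrow> 'b::polish_space"
  assumes \<sigma>1: "\<sigma>\<^sub>1 \<in> borel_probs" and \<sigma>2: "\<sigma>\<^sub>2 \<in> borel_probs"
    and [measurable]: "\<phi> \<in> borel_measurable borel" and inj: "inj \<phi>"
    and eq: "distr \<sigma>\<^sub>1 borel \<phi> = distr \<sigma>\<^sub>2 borel \<phi>"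
    and B[measurable]: "B \<in> sets borel"
  shows "emeasure \<sigma>\<^sub>1 B \<le> emeasure \<sigma>\<^sub>2 B"
proof -
  have [measurable_cong]: "sets \<sigma>\<^sub>1 = sets borel" "sets \<sigma>\<^sub>2 = sets borel"
    and "prob_space \<sigma>\<^sub>1"
    using \<sigma>1 \<sigma>2 by (auto simp: space_prob_algebra)
  interpret prob_space \<sigma>\<^sub>1 by fact
  \<comment> \<open>A measurable \<phi> need not preserve compactness; on the graph it is replaced
    by the continuous projection \<open>snd\<close>.\<close>
  let ?g = "\<lambda>x. (x, \<phi> x)"
  have [measurable]: "?g \<in> \<sigma>\<^sub>1 \<rightarrow>\<^sub>M borel"
    by (simp add: borel_prod[symmetric])
  let ?M = "distr \<sigma>\<^sub>1 borel ?g"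
  interpret M: prob_space ?M by (rule prob_space_distr) simp
  have sp: "space \<sigma>\<^sub>1 = UNIV" "space \<sigma>\<^sub>2 = UNIV"
    using sets_eq_imp_space_eq[of \<sigma>\<^sub>1 borel] sets_eq_imp_space_eq[of \<sigma>\<^sub>2 borel]
      \<open>sets \<sigma>\<^sub>1 = sets borel\<close> \<open>sets \<sigma>\<^sub>2 = sets borel\<close> by auto
  define G where "G = {p. fst p \<in> B \<and> \<phi> (fst p) = snd p}"
  have "{p \<in> space (borel \<Otimes>\<^sub>M borel). fst p \<in> B \<and> \<phi> (fst p) = snd p} \<in> sets (borel \<Otimes>\<^sub>M borel)"
    by measurable
  then have G: "G \<in> sets borel"
    unfolding G_def borel_prod by simp
  have "emeasure \<sigma>\<^sub>1 B = emeasure ?M G"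
    using G by (simp add: emeasure_distr sp) (simp add: G_def vimage_def)
  also have "\<dots> = (SUP K\<in>{K. K \<subseteq> G \<and> compact K}. emeasure ?M K)"
    using G by (intro inner_regular) auto
  also have "\<dots> \<le> emeasure \<sigma>\<^sub>2 B"
  proof (rule SUP_least)
    fix K assume "K \<in> {K. K \<subseteq> G \<and> compact K}"
    then have K: "K \<subseteq> G" "compact K" by auto
    have [measurable]: "snd ` K \<in> sets borel" "fst ` K \<in> sets borel" "K \<in> sets borel"
      using K by (auto intro!: borel_compact compact_continuous_image continuous_intros)
    \<comment> \<open>The first equation uses injectivity, the second that \<open>K\<close> lies in
      the graph.\<close>
    have pre: "\<phi> -` (snd ` K) = fst ` K" "?g -` K = fst ` K"
      using K(1) inj by (force simp: G_def inj_def image_iff)+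
    have "emeasure ?M K = emeasure \<sigma>\<^sub>1 (fst ` K)"
      using pre by (simp add: emeasure_distr sp)
    also have "\<dots> = emeasure (distr \<sigma>\<^sub>1 borel \<phi>) (snd ` K)"
      using pre by (simp add: emeasure_distr sp)
    also have "\<dots> = emeasure \<sigma>\<^sub>2 (fst ` K)"
      unfolding eq using pre by (simp add: emeasure_distr sp)
    also have "\<dots> \<le> emeasure \<sigma>\<^sub>2 B"
      using K by (intro emeasure_mono) (auto simp: G_def)
    finally show "emeasure ?M K \<le> emeasure \<sigma>\<^sub>2 B" .
  qed
  finally show ?thesis .
qed

lemma distr_inj_eq_imp_eq:
  fixes \<phi> :: "'a::polish_space \<Rightarrow> 'b::polish_space"
  assumes "\<sigma>\<^sub>1 \<in> borel_probs" "\<sigma>\<^sub>2 \<in> borel_probs"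
    and "\<phi> \<in> borel_measurable borel" "inj \<phi>"
    and "distr \<sigma>\<^sub>1 borel \<phi> = distr \<sigma>\<^sub>2 borel \<phi>"
  shows "\<sigma>\<^sub>1 = \<sigma>\<^sub>2"
proof (rule measure_eqI)
  show "sets \<sigma>\<^sub>1 = sets \<sigma>\<^sub>2"
    using assms(1,2) by (simp add: space_prob_algebra)
  show "emeasure \<sigma>\<^sub>1 B = emeasure \<sigma>\<^sub>2 B" if "B \<in> sets \<sigma>\<^sub>1" for B
    using that assms
    by (intro antisym emeasure_le_of_distr_inj_eq[of _ _ \<phi>]) (auto simp: space_prob_algebra)
qed

section \<open>Nearest points of a closed subset of the line\<close>

text \<open>A point with nearest points of \<open>S\<close> on both sides is the midpoint of a gap
  of \<open>S\<close> that contains the open interval from \<open>a\<close> to \<open>b\<close>, and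
  there is only one such gap.\<close>

lemma infdist_attained_both_sides_unique:
  fixes S :: "real set"
  assumes S: "closed S" and "a < b"
    and ne: "S \<inter> {..a} \<noteq> {}" "S \<inter> {b..} \<noteq> {}"
    and y: "infdist y (S \<inter> {..a}) = infdist y S" "infdist y (S \<inter> {b..}) = infdist y S"
    and z: "infdist z (S \<inter> {..a}) = infdist z S" "infdist z (S \<inter> {b..}) = infdist z S"
  shows "y = z"
proof -
  have midpoint: "\<exists>s t. s \<in> S \<and> t \<in> S \<and> s \<le> a \<and> b \<le> t \<and> 2 * x = s + t \<and> (\<forall>u\<in>S. u \<le> s \<or> t \<le> u)"
    if "infdist x (S \<inter> {..a}) = infdist x S" "infdist x (S \<inter> {b..}) = infdist x S" for x
  proof -
    obtain s where s: "s \<in> S \<inter> {..a}" "infdist x (S \<inter> {..a}) = dist x s"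
      using infdist_attains_inf[of "S \<inter> {..a}" x] ne S by (auto simp: closed_Int)
    obtain t where t: "t \<in> S \<inter> {b..}" "infdist x (S \<inter> {b..}) = dist x t"
      using infdist_attains_inf[of "S \<inter> {b..}" x] ne S by (auto simp: closed_Int)
    have "\<forall>u\<in>S. dist x s \<le> dist x u"
      using infdist_le[of _ S x] s that by auto
    moreover have "dist x s = dist x t" using s t that by simp
    ultimately show ?thesis
      using s t \<open>a < b\<close>
      by (intro exI[of _ s] exI[of _ t]) (force simp: dist_real_def abs_if split: if_splits)
  qed
  obtain s t where 1: "s \<in> S" "t \<in> S" "s \<le> a" "b \<le> t" "2 * y = s + t" "\<forall>u\<in>S. u \<le> s \<or> t \<le> u"
    using midpoint y by blast
  obtain s' t' where 2: "s' \<in> S" "t' \<in> S" "s' \<le> a" "b \<le> t'" "2 * z = s' + t'" "\<forall>u\<in>S. u \<le> s' \<or> t' \<le> u"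
    using midpoint z by blast
  \<comment> \<open>Each endpoint lies in \<open>S\<close>, so it cannot fall inside the other gap,
    and \<open>a < b\<close> keeps left and right endpoints apart.\<close>
  have "s = s'" "t = t'" using 1 2 \<open>a < b\<close> by force+
  with 1 2 show ?thesis by simp
qed

section \<open>An upper bound for the infimum, and its finiteness\<close>

text \<open>A nearest point of the closure may lie outside the range of \<phi>, so each
  \<open>y\<close> is sent to a point of the range at distance less than \<open>e\<close> above
  optimal. Choosing from a countable dense set by least index makes the selection
  measurable.\<close>

lemma INF_W1_objective_le:
  fixes \<phi> :: "'a::topological_space \<Rightarrow> real"
  assumes \<nu>: "\<nu> \<in> borel_probs" and [measurable]: "\<phi> \<in> borel_measurable borel"
  shows "(INF \<sigma>\<in>borel_probs. W1_objective \<phi> \<nu> \<sigma>)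
           \<le> (\<integral>\<^sup>+y. ennreal (infdist y (closure (range \<phi>))) \<partial>\<nu>)"
proof (rule ennreal_le_epsilon)
  fix e :: real assume "0 < e"
  have [measurable_cong]: "sets \<nu> = sets borel" and "prob_space \<nu>"
    using \<nu> by (auto simp: space_prob_algebra)
  interpret prob_space \<nu> by fact
  let ?S = "closure (range \<phi>)"
  obtain T where T: "countable T" "T \<subseteq> range \<phi>" "range \<phi> \<subseteq> closure T"
    by (rule separable)
  then have "T \<noteq> {}" by auto
  have clT: "closure T = ?S"
    using T by (simp add: antisym closure_minimal closure_mono)
  \<comment> \<open>Preimages are enumerated, so that the selection yields a measure on the domain
    of \<phi>; a finite \<open>T\<close> is enumerated with repetitions.\<close>
  obtain x :: "nat \<Rightarrow> 'a" where x: "range (\<lambda>n. \<phi> (x n)) = T"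
  proof -
    have "\<forall>n. \<exists>x. \<phi> x = from_nat_into T n"
      using from_nat_into[OF \<open>T \<noteq> {}\<close>] T(2) by (metis imageE subsetD)
    then obtain x where "\<forall>n. \<phi> (x n) = from_nat_into T n" by metis
    then have "range (\<lambda>n. \<phi> (x n)) = range (from_nat_into T)" by simp
    then show ?thesis
      using that range_from_nat_into[OF \<open>T \<noteq> {}\<close> T(1)] by metis
  qed
  have ex: "\<exists>n. \<bar>\<phi> (x n) - y\<bar> < infdist y ?S + e" for y
  proof -
    obtain c where c: "c \<in> ?S" "infdist y ?S = dist y c"
      using infdist_attains_inf[of ?S y] by auto
    then obtain t where t: "t \<in> T" "dist t c < e"
      using clT \<open>0 < e\<close> closure_approachable[of c T] by auto
    then have "dist y t < infdist y ?S + e"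
      using c dist_triangle[of y t c] by (simp add: dist_commute)
    with t(1) show ?thesis
      using x by (force simp: dist_real_def abs_minus_commute)
  qed
  define N where "N y = (LEAST n. \<bar>\<phi> (x n) - y\<bar> < infdist y ?S + e)" for y
  have N: "\<bar>\<phi> (x (N y)) - y\<bar> \<le> infdist y ?S + e" for y
    using LeastI_ex[OF ex[of y]] by (simp add: N_def)
  have [measurable]: "(\<lambda>y. infdist y ?S) \<in> borel_measurable borel"
    by (intro borel_measurable_continuous_onI continuous_intros)
  have [measurable]: "N \<in> borel \<rightarrow>\<^sub>M count_space UNIV"
    unfolding N_def by measurable
  have [measurable]: "(\<lambda>y. x (N y)) \<in> borel \<rightarrow>\<^sub>M borel"
    by (rule measurable_compose[of N _ "count_space UNIV"]) auto
  let ?\<sigma> = "distr \<nu> borel (\<lambda>y. x (N y))"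
  let ?h = "\<lambda>y. (\<phi> (x (N y)), y)"
  have [measurable]: "?h \<in> \<nu> \<rightarrow>\<^sub>M borel" by (simp add: borel_prod[symmetric])
  \<comment> \<open>The coupling induced by the selection map: the second coordinate is
    \<open>y\<close> itself, the first its target.\<close>
  let ?\<Gamma> = "distr \<nu> borel ?h"
  have [measurable]: "fst \<in> (borel :: (real \<times> real) measure) \<rightarrow>\<^sub>M borel"
    "snd \<in> (borel :: (real \<times> real) measure) \<rightarrow>\<^sub>M borel"
    by (simp_all add: borel_prod[symmetric])
  have \<sigma>: "?\<sigma> \<in> borel_probs"
    by (auto simp: space_prob_algebra intro!: prob_space_distr)
  have "?\<Gamma> \<in> couplings (distr ?\<sigma> borel \<phi>) \<nu>"
    unfolding couplings_def
    by (auto simp: space_prob_algebra distr_distr comp_def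
        \<open>sets \<nu> = sets borel\<close>[symmetric] intro!: distr_id2 prob_space_distr)
  then have "W1_objective \<phi> \<nu> ?\<sigma> \<le> (\<integral>\<^sup>+(y', y). ennreal \<bar>y' - y\<bar> \<partial>?\<Gamma>)"
    unfolding W1_objective_def W1_def by (rule INF_lower)
  also have "\<dots> = (\<integral>\<^sup>+y. ennreal \<bar>\<phi> (x (N y)) - y\<bar> \<partial>\<nu>)"
    by (subst nn_integral_distr) (auto simp: case_prod_beta)
  also have "\<dots> \<le> (\<integral>\<^sup>+y. ennreal (infdist y ?S) + ennreal e \<partial>\<nu>)"
    using N \<open>0 < e\<close> by (intro nn_integral_mono) (simp add: ennreal_plus[symmetric] infdist_nonneg
      del: ennreal_plus)
  also have "\<dots> = (\<integral>\<^sup>+y. ennreal (infdist y ?S) \<partial>\<nu>) + ennreal e"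
    by (subst nn_integral_add) (auto simp: emeasure_space_1)
  finally show "(INF \<sigma>\<in>borel_probs. W1_objective \<phi> \<nu> \<sigma>)
      \<le> (\<integral>\<^sup>+y. ennreal (infdist y ?S) \<partial>\<nu>) + ennreal e"
    by (rule INF_lower2[OF \<sigma>])
qed

lemma nn_integral_infdist_finite:
  assumes "\<nu> \<in> borel_probs1" and "S \<noteq> {}"
  shows "(\<integral>\<^sup>+y. ennreal (infdist y S) \<partial>\<nu>) < \<infinity>"
proof -
  have \<nu>: "sets \<nu> = sets borel" "prob_space \<nu>" and int: "integrable \<nu> (\<lambda>y. \<bar>y\<bar>)"
    using assms by (auto simp: borel_probs1_def space_prob_algebra)
  interpret prob_space \<nu> by fact
  obtain s where "s \<in> S" using assms by auto
  \<comment> \<open>One fixed point of \<open>S\<close> dominates the distance, which reduces the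
    claim to the first moment of \<nu>.\<close>
  have "infdist y S \<le> \<bar>y\<bar> + \<bar>s\<bar>" for y
    using infdist_le[OF \<open>s \<in> S\<close>, of y] by (simp add: dist_real_def)
  then have "(\<integral>\<^sup>+y. ennreal (infdist y S) \<partial>\<nu>) \<le> (\<integral>\<^sup>+y. ennreal (\<bar>y\<bar> + \<bar>s\<bar>) \<partial>\<nu>)"
    by (intro nn_integral_mono ennreal_leI)
  also have "\<dots> < \<infinity>"
  proof -
    have "integrable \<nu> (\<lambda>y. \<bar>y\<bar> + \<bar>s\<bar>)"
      using int by simp
    then show ?thesis
      by (subst nn_integral_eq_integral) auto
  qed
  finally show ?thesis .
qed

section \<open>Constraints on the image of a minimizer\<close>

text \<open>Every coupling pays at least the distance to \<open>S\<close>, and mass sent into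
  \<open>C\<close> from points whose nearest points avoid \<open>C\<close> pays extra. Since the
  cost can be brought arbitrarily close to \<open>?D\<close>, such mass must vanish in the
  limit.\<close>

lemma W1_minimizer_closed_bound:
  fixes \<phi> :: "'a::topological_space \<Rightarrow> real"
  assumes \<nu>: "\<nu> \<in> borel_probs1" and [measurable]: "\<phi> \<in> borel_measurable borel"
    and min: "is_W1_minimizer \<phi> \<nu> \<sigma>"
    and S_def: "S = closure (range \<phi>)" and C: "closed C" "S \<inter> C \<noteq> {}"
  shows "measure (distr \<sigma> borel \<phi>) C \<le> measure \<nu> {y. infdist y (S \<inter> C) = infdist y S}"
proof -
  have [measurable_cong]: "sets \<nu> = sets borel" and "prob_space \<nu>"
    using \<nu> by (auto simp: borel_probs1_def space_prob_algebra)
  interpret \<nu>: prob_space \<nu> by fact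
  have sp: "space \<nu> = UNIV"
    using sets_eq_imp_space_eq[OF \<open>sets \<nu> = sets borel\<close>] by simp
  have [measurable_cong]: "sets \<sigma> = sets borel" and "prob_space \<sigma>"
    using min by (auto simp: is_W1_minimizer_def space_prob_algebra)
  interpret \<sigma>: prob_space \<sigma> by fact
  let ?\<mu> = "distr \<sigma> borel \<phi>"
  have [measurable]: "C \<in> sets borel" "S \<in> sets borel"
    using C S_def by (auto intro: borel_closed)
  have [measurable]: "(\<lambda>y. infdist y A) \<in> borel_measurable borel" for A :: "real set"
    by (intro borel_measurable_continuous_onI continuous_intros)
  have [measurable]: "fst \<in> (borel :: (real \<times> real) measure) \<rightarrow>\<^sub>M borel"
    "snd \<in> (borel :: (real \<times> real) measure) \<rightarrow>\<^sub>M borel"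
    by (simp_all add: borel_prod[symmetric])
  let ?D = "\<integral>\<^sup>+y. ennreal (infdist y S) \<partial>\<nu>"
  have fin: "?D < \<infinity>"
    using nn_integral_infdist_finite[OF \<nu>, of S] C by auto
  have W: "W1 ?\<mu> \<nu> \<le> ?D"
    using min INF_W1_objective_le[of \<nu> \<phi>] \<nu>
    unfolding S_def by (simp add: is_W1_minimizer_def W1_objective_def borel_probs1_def)
  \<comment> \<open>The extra distance forced on \<open>y\<close> when its target must lie in
    \<open>C\<close>.\<close>
  define k where "k y = infdist y (S \<inter> C) - infdist y S" for y
  have [measurable]: "k \<in> borel_measurable borel" unfolding k_def by measurable
  have k_nonneg: "0 \<le> k y" for y
    using infdist_mono[of "S \<inter> C" S y] C by (simp add: k_def)
  have approx: "\<eta> * measure ?\<mu> C \<le> \<eta> * measure \<nu> {y. k y < \<eta>} + e" if "0 < \<eta>" "0 < e" for \<eta> e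
  proof -
    have "?D < ?D + ennreal e"
      using fin \<open>0 < e\<close> by (cases ?D) (auto simp: ennreal_plus[symmetric] ennreal_less_iff
        simp del: ennreal_plus)
    with W have "W1 ?\<mu> \<nu> < ?D + ennreal e" by (rule le_less_trans)
    then obtain \<Gamma> where \<Gamma>: "\<Gamma> \<in> couplings ?\<mu> \<nu>"
      and cost: "(\<integral>\<^sup>+(y', y). ennreal \<bar>y' - y\<bar> \<partial>\<Gamma>) < ?D + ennreal e"
      unfolding W1_def by (auto simp: INF_less_iff)
    have [measurable_cong]: "sets \<Gamma> = sets borel" and "prob_space \<Gamma>"
      and d1: "distr \<Gamma> borel fst = ?\<mu>" and d2: "distr \<Gamma> borel snd = \<nu>"
      using \<Gamma> by (auto simp: couplings_def space_prob_algebra)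
    interpret \<Gamma>: prob_space \<Gamma> by fact
    have sp\<Gamma>: "space \<Gamma> = UNIV"
      using sets_eq_imp_space_eq[OF \<open>sets \<Gamma> = sets borel\<close>] by simp
    have "AE y in ?\<mu>. y \<in> S"
      using closure_subset[of "range \<phi>"] by (subst AE_distr_iff) (auto simp: S_def)
    \<comment> \<open>Targets lie in \<open>S\<close> almost surely, so \<open>infdist y S\<close>
      bounds the transport distance from below.\<close>
    then have inS: "AE p in \<Gamma>. fst p \<in> S"
      unfolding d1[symmetric] by (subst (asm) AE_distr_iff) auto
    define A where "A = {p::real\<times>real. fst p \<in> C \<and> \<eta> \<le> k (snd p)}"
    have "{p\<in>space borel. fst p \<in> C \<and> \<eta> \<le> k (snd p)} \<in> sets (borel :: (real\<times>real) measure)"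
      by measurable
    then have [measurable]: "A \<in> sets borel" by (simp add: A_def)
    \<comment> \<open>The second marginal turns \<open>?D\<close> into an integral over \<Gamma>,
      and pairs in \<open>A\<close> cost at least \<eta> more than the distance to
      \<open>S\<close>.\<close>
    have "?D + ennreal \<eta> * emeasure \<Gamma> A
        = (\<integral>\<^sup>+p. ennreal (infdist (snd p) S) + ennreal \<eta> * indicator A p \<partial>\<Gamma>)"
      by (subst d2[symmetric], subst nn_integral_distr)
         (auto simp: nn_integral_add nn_integral_cmult_indicator)
    also have "\<dots> \<le> (\<integral>\<^sup>+(y', y). ennreal \<bar>y' - y\<bar> \<partial>\<Gamma>)"
    proof (rule nn_integral_mono_AE)
      show "AE p in \<Gamma>. ennreal (infdist (snd p) S) + ennreal \<eta> * indicator A p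
          \<le> (case p of (y', y) \<Rightarrow> ennreal \<bar>y' - y\<bar>)"
        using inS
      proof eventually_elim
        case (elim p)
        obtain y' y where p: "p = (y', y)" by (cases p)
        have le: "infdist y S \<le> \<bar>y' - y\<bar>"
          using infdist_le[of y' S y] elim by (simp add: p dist_real_def abs_minus_commute)
        show ?case
        proof (cases "p \<in> A")
          case True
          then have "infdist y (S \<inter> C) \<le> \<bar>y' - y\<bar>" "\<eta> \<le> k y"
            using infdist_le[of y' "S \<inter> C" y] elim
            by (auto simp: A_def p dist_real_def abs_minus_commute)
          then have "infdist y S + \<eta> \<le> \<bar>y' - y\<bar>" by (simp add: k_def)
          then show ?thesis
            using True \<open>0 < \<eta>\<close> infdist_nonneg[of y S]
            by (simp add: p ennreal_plus[symmetric] del: ennreal_plus)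
        qed (use le in \<open>simp add: p\<close>)
      qed
    qed
    also note cost
    \<comment> \<open>Cancelling \<open>?D\<close> is legitimate because it is finite.\<close>
    finally have "ennreal \<eta> * emeasure \<Gamma> A \<le> ennreal e"
      using fin by (auto simp: ennreal_add_left_cancel_less intro: less_imp_le)
    then have A_le: "\<eta> * measure \<Gamma> A \<le> e"
      using \<open>0 < \<eta>\<close> \<open>0 < e\<close> by (simp add: \<Gamma>.emeasure_eq_measure ennreal_mult[symmetric])
    have "measure ?\<mu> C = measure \<Gamma> (fst -` C)"
      unfolding d1[symmetric] by (subst measure_distr) (auto simp: sp\<Gamma>)
    also have "\<dots> \<le> measure \<Gamma> (A \<union> snd -` {y. k y < \<eta>})"
    proof (rule \<Gamma>.finite_measure_mono)
      have "{p\<in>space borel. k (snd p) < \<eta>} \<in> sets (borel :: (real\<times>real) measure)"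
        by measurable
      then show "A \<union> snd -` {y. k y < \<eta>} \<in> sets \<Gamma>"
        by (simp add: vimage_def \<open>sets \<Gamma> = sets borel\<close>)
    qed (auto simp: A_def)
    also have "\<dots> \<le> measure \<Gamma> A + measure \<Gamma> (snd -` {y. k y < \<eta>})"
    proof (rule measure_Un_le)
      have "{p\<in>space borel. k (snd p) < \<eta>} \<in> sets (borel :: (real\<times>real) measure)"
        by measurable
      then show "snd -` {y. k y < \<eta>} \<in> sets \<Gamma>"
        by (simp add: vimage_def \<open>sets \<Gamma> = sets borel\<close>)
    qed simp
    also have "measure \<Gamma> (snd -` {y. k y < \<eta>}) = measure \<nu> {y. k y < \<eta>}"
      by (subst d2[symmetric], subst measure_distr) (auto simp: sp\<Gamma>)
    finally have "\<eta> * measure ?\<mu> C \<le> \<eta> * (measure \<Gamma> A + measure \<nu> {y. k y < \<eta>})"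
      using \<open>0 < \<eta>\<close> by simp
    with A_le show ?thesis by (simp add: distrib_left)
  qed
  \<comment> \<open>The coupling depends on \<open>e\<close>, but \<open>approx\<close> no longer
    mentions it, so \<open>e\<close> can tend to 0 with \<eta> fixed.\<close>
  have bound: "measure ?\<mu> C \<le> measure \<nu> {y. k y < \<eta>}" if "0 < \<eta>" for \<eta>
  proof -
    have "\<eta> * measure ?\<mu> C \<le> \<eta> * measure \<nu> {y. k y < \<eta>}"
      using approx[OF that] by (rule field_le_epsilon)
    with that show ?thesis by simp
  qed
  \<comment> \<open>Now \<eta> tends to 0; these sets decrease to the zero set of
    \<open>k\<close>.\<close>
  let ?B = "\<lambda>n::nat. {y. k y < inverse (real (Suc n))}"
  have "(\<lambda>n. measure \<nu> (?B n)) \<longlonglongrightarrow> measure \<nu> (\<Inter>n. ?B n)"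
  proof (rule \<nu>.finite_Lim_measure_decseq)
    show "range ?B \<subseteq> sets \<nu>"
      by (auto simp: \<open>sets \<nu> = sets borel\<close>)
    show "decseq ?B"
      by (rule antimonoI) (auto elim!: less_le_trans intro!: le_imp_inverse_le)
  qed
  then have "measure ?\<mu> C \<le> measure \<nu> (\<Inter>n. ?B n)"
    by (rule LIMSEQ_le_const) (auto intro!: bound)
  also have "(\<Inter>n. ?B n) = {y. infdist y (S \<inter> C) = infdist y S}"
  proof -
    have "(\<forall>n. k y < inverse (real (Suc n))) \<longleftrightarrow> k y = 0" for y
    proof
      assume "\<forall>n. k y < inverse (real (Suc n))"
      then have "\<not> 0 < k y"
        using reals_Archimedean[of "k y"] by (meson less_asym)
      with k_nonneg[of y] show "k y = 0" by simp
    qed simp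
    then show ?thesis by (auto simp: k_def)
  qed
  finally show ?thesis .
qed

text \<open>Covers half lines that miss \<open>S\<close>, where the previous bound does not apply:
  \<open>infdist\<close> to the empty set is 0 by convention.\<close>

lemma W1_minimizer_null_outside:
  fixes \<phi> :: "'a::topological_space \<Rightarrow> real"
  assumes "is_W1_minimizer \<phi> \<nu> \<sigma>" and "\<phi> \<in> borel_measurable borel"
    and "closed C" "closure (range \<phi>) \<inter> C = {}"
  shows "measure (distr \<sigma> borel \<phi>) C = 0"
proof -
  have "sets \<sigma> = sets borel"
    using assms by (auto simp: is_W1_minimizer_def space_prob_algebra)
  moreover have "\<phi> -` C = {}"
    using assms(4) closure_subset[of "range \<phi>"] by blast
  ultimately show ?thesis
    using assms by (subst measure_distr) (auto simp: cong: measurable_cong_sets)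
qed

text \<open>The closed bound is applied to \<open>{..a}\<close> for one minimizer and to
  \<open>{b..}\<close> for the other. The two \<nu>-sets overlap in a null set, so the masses add up
  to at most 1; passing to complements and letting \<open>b\<close> decrease to \<open>a\<close>
  compares the distribution functions.\<close>

lemma W1_minimizer_cdf_le:
  fixes \<phi> :: "'a::topological_space \<Rightarrow> real"
  assumes \<nu>: "\<nu> \<in> borel_probs1" "atomless \<nu>" and \<phi>: "\<phi> \<in> borel_measurable borel"
    and min: "is_W1_minimizer \<phi> \<nu> \<sigma>\<^sub>1" "is_W1_minimizer \<phi> \<nu> \<sigma>\<^sub>2"
  shows "cdf (distr \<sigma>\<^sub>1 borel \<phi>) a \<le> cdf (distr \<sigma>\<^sub>2 borel \<phi>) a"
proof -
  let ?\<mu>1 = "distr \<sigma>\<^sub>1 borel \<phi>" and ?\<mu>2 = "distr \<sigma>\<^sub>2 borel \<phi>"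
  let ?S = "closure (range \<phi>)"
  have \<nu>s[measurable_cong]: "sets \<nu> = sets borel" and "prob_space \<nu>"
    using \<nu> by (auto simp: borel_probs1_def space_prob_algebra)
  interpret \<nu>: prob_space \<nu> by fact
  have \<sigma>2: "sets \<sigma>\<^sub>2 = sets borel" "prob_space \<sigma>\<^sub>2"
    using min by (auto simp: is_W1_minimizer_def space_prob_algebra)
  interpret \<mu>2: real_distribution ?\<mu>2
    using \<sigma>2 \<phi> by (intro prob_space.real_distribution_distr) (auto cong: measurable_cong_sets)
  have [measurable]: "(\<lambda>y. infdist y A) \<in> borel_measurable borel" for A :: "real set"
    by (intro borel_measurable_continuous_onI continuous_intros)
  \<comment> \<open>Strictness matters: for \<open>b = a\<close> in \<open>?S\<close>, every
    \<open>y\<close> nearest to \<open>a\<close> would lie in both sets.\<close>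
  have step: "measure ?\<mu>1 {..a} \<le> cdf ?\<mu>2 b" if "a < b" for b
  proof -
    have compl: "measure ?\<mu>2 {..b} \<ge> 1 - measure ?\<mu>2 {b..}"
    proof -
      have "{..b} \<union> {b..} = UNIV" by auto
      then have "1 = measure ?\<mu>2 ({..b} \<union> {b..})"
        using \<mu>2.prob_space by simp
      also have "\<dots> \<le> measure ?\<mu>2 {..b} + measure ?\<mu>2 {b..}"
        by (intro measure_Un_le) auto
      finally show ?thesis by simp
    qed
    let ?N = "\<lambda>C. {y. infdist y (?S \<inter> C) = infdist y ?S}"
    have [measurable]: "?N C \<in> sets \<nu>" for C
      unfolding \<nu>s by measurable
    consider (left) "?S \<inter> {..a} = {}" | (right) "?S \<inter> {b..} = {}"
      | (both) "?S \<inter> {..a} \<noteq> {}" "?S \<inter> {b..} \<noteq> {}" by blast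
    then show ?thesis
    proof cases
      case left
      then show ?thesis
        using W1_minimizer_null_outside[OF min(1) \<phi>, of "{..a}"] by (simp add: \<mu>2.cdf_nonneg)
    next
      case right
      have "measure ?\<mu>1 {..a} \<le> 1"
      proof (rule prob_space.prob_le_1)
        show "prob_space ?\<mu>1"
          using min(1) \<phi> by (intro prob_space.prob_space_distr)
            (auto simp: is_W1_minimizer_def space_prob_algebra cong: measurable_cong_sets)
      qed
      with right show ?thesis
        using W1_minimizer_null_outside[OF min(2) \<phi>, of "{b..}"] compl by (simp add: cdf_def)
    next
      case both
      have "measure ?\<mu>1 {..a} + measure ?\<mu>2 {b..} \<le> measure \<nu> (?N {..a}) + measure \<nu> (?N {b..})"
        using both by (intro add_mono W1_minimizer_closed_bound[OF \<nu>(1) \<phi> _ refl] min) auto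
      also have "\<dots> = measure \<nu> (?N {..a} \<union> ?N {b..})"
      proof (rule measure_Un_AE[symmetric])
        have "\<exists>m. ?N {..a} \<inter> ?N {b..} \<subseteq> {m}"
          using infdist_attained_both_sides_unique[OF closed_closure \<open>a < b\<close> both] by blast
        then obtain m where m: "?N {..a} \<inter> ?N {b..} \<subseteq> {m}" by blast
        have "{m} \<in> null_sets \<nu>"
          using atomless_emeasure_singleton[OF \<nu>(2), of m] by (auto simp: \<nu>s)
        then show "AE y in \<nu>. y \<notin> ?N {..a} \<or> y \<notin> ?N {b..}"
          by (rule AE_I') (use m in auto)
      qed (auto simp: fmeasurable_def \<nu>.emeasure_eq_measure)
      also have "\<dots> \<le> 1" by (rule \<nu>.prob_le_1)
      finally show ?thesis
        using compl by (simp add: cdf_def)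
    qed
  qed
  \<comment> \<open>Right continuity closes the gap between \<open>a\<close> and
    \<open>b\<close>.\<close>
  have "(cdf ?\<mu>2 \<longlongrightarrow> cdf ?\<mu>2 a) (at_right a)"
    using \<mu>2.cdf_is_right_cont[of a] by (simp add: continuous_within)
  then have "measure ?\<mu>1 {..a} \<le> cdf ?\<mu>2 a"
    by (rule tendsto_lowerbound)
       (auto simp: eventually_at_right_field intro: step exI[of _ "a + 1"])
  then show ?thesis by (simp add: cdf_def)
qed

theorem proposition2p8:
  fixes \<phi> :: "'a::polish_space \<Rightarrow> real" and \<nu> :: "real measure"
  assumes "\<nu> \<in> borel_probs1"
    and "atomless \<nu>"
    and "\<phi> \<in> borel_measurable borel"
    and "inj \<phi>"
  shows "(\<forall>\<sigma>\<^sub>1 \<sigma>\<^sub>2. is_W1_minimizer \<phi> \<nu> \<sigma>\<^sub>1 \<and> is_W1_minimizer \<phi> \<nu> \<sigma>\<^sub>2 \<longrightarrow> \<sigma>\<^sub>1 = \<sigma>\<^sub>2)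
    \<longleftrightarrow> (INF \<sigma>\<in>borel_probs. W1_objective \<phi> \<nu> \<sigma>) < \<infinity>"
proof -
  \<comment> \<open>The finite first moment makes the problem feasible, so the equivalence follows
    by proving both of its sides.\<close>
  have "(INF \<sigma>\<in>borel_probs. W1_objective \<phi> \<nu> \<sigma>) < \<infinity>"
    using INF_W1_objective_le[of \<nu> \<phi>] nn_integral_infdist_finite[of \<nu> "closure (range \<phi>)"] assms
    by (auto simp: borel_probs1_def intro: le_less_trans)
  moreover have "\<sigma>\<^sub>1 = \<sigma>\<^sub>2" if min: "is_W1_minimizer \<phi> \<nu> \<sigma>\<^sub>1" "is_W1_minimizer \<phi> \<nu> \<sigma>\<^sub>2" for \<sigma>\<^sub>1 \<sigma>\<^sub>2
  proof (rule distr_inj_eq_imp_eq)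
    show \<sigma>: "\<sigma>\<^sub>1 \<in> borel_probs" "\<sigma>\<^sub>2 \<in> borel_probs"
      using min by (auto simp: is_W1_minimizer_def)
    have "real_distribution (distr \<sigma> borel \<phi>)" if "\<sigma> \<in> borel_probs" for \<sigma>
      using that assms(3) by (intro prob_space.real_distribution_distr)
        (auto simp: space_prob_algebra cong: measurable_cong_sets)
    \<comment> \<open>The comparison is used with the two minimizers in either order.\<close>
    moreover have "cdf (distr \<sigma>\<^sub>1 borel \<phi>) = cdf (distr \<sigma>\<^sub>2 borel \<phi>)"
      using W1_minimizer_cdf_le[OF assms(1-3)] min by (intro ext antisym) auto
    ultimately show "distr \<sigma>\<^sub>1 borel \<phi> = distr \<sigma>\<^sub>2 borel \<phi>"
      using \<sigma> by (intro cdf_unique) auto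
  qed (use assms in auto)
  ultimately show ?thesis by blast
qed

end
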